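(* Let $\rho,\sigma$ be gauges and let $x,y,z:{}^{\sigma}\widetilde{\mathbb N}\to{}^{\rho}\widetilde{\mathbb R}$ be hypersequences. Then: (i) If the hyperlimits of $(x_n)_n$ and $(y_n)_n$ exist and the hyperlimit of $(x_n)_n$ is $<$ the hyperlimit of $(y_n)_n$, then there exists $M\in{}^{\sigma}\widetilde{\mathbb N}$ such that $x_n<y_n$ for all $n\in{}^{\sigma}\widetilde{\mathbb N}$ with $n\ge M$. (ii) If $x_n\le y_n\le z_n$ for all $n\in{}^{\sigma}\widetilde{\mathbb N}$ and the hyperlimits of $(x_n)_n$ and $(z_n)_n$ exist and are both equal to $l$, then the hyperlimit of $(y_n)_n$ exists and equals $l$.
   Context: Let $I=(0,1]$. A gauge is a net $\rho=(\rho_\varepsilon)_{\varepsilon\in I}\in(0,1]^I$ with $\rho_\varepsilon\to0$ as $\varepsilon\to0^+$. "$\forall^0\varepsilon:\ P(\varepsilon)$" means: there is $\varepsilon_0\in I$ such that $P(\varepsilon)$ holds for all $\varepsilon\in(0,\varepsilon_0]$. $\mathbb R_\rho$ is the ring of $\rho$-moderate nets: $(x_\varepsilon)\in\mathbb R^I$ with $\exists N\in\mathbb N\,\forall^0\varepsilon:\ |x_\varepsilon|\le\rho_\varepsilon^{-N}$. Write $(x_\varepsilon)\sim_\rho(y_\varepsilon)$ if $\forall n\in\mathbb N\,\forall^0\varepsilon:\ |x_\varepsilon-y_\varepsilon|\le\rho_\varepsilon^n$; a net is $\rho$-negligible if it is $\sim_\rho 0$. ${}^{\rho}\widetilde{\mathbb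 R}:=\mathbb R_\rho/\sim_\rho$ (a ring with pointwise operations); classes are denoted $[x_\varepsilon]$. Order: $[x_\varepsilon]\le[y_\varepsilon]$ iff there is a $\rho$-negligible $(z_\varepsilon)$ with $\forall^0\varepsilon:\ x_\varepsilon\le y_\varepsilon+z_\varepsilon$; $x<y$ means $x\le y$ and $y-x$ is invertible. $|[x_\varepsilon]|:=[|x_\varepsilon|]$, and $\mathrm d\rho:=[\rho_\varepsilon]$. Given a gauge $\sigma$, ${}^{\sigma}\widetilde{\mathbb N}:=\{[n_\varepsilon]\in{}^{\sigma}\widetilde{\mathbb R}\mid n_\varepsilon\in\mathbb N\ \forall\varepsilon\}$, ordered by the order $\le$ of ${}^{\sigma}\widetilde{\mathbb R}$. A hypersequence is a map $x:{}^{\sigma}\widetilde{\mathbb N}\to{}^{\rho}\widetilde{\mathbb R}$, $x_n:=x(n)$. An element $l\in{}^{\rho}\widetilde{\mathbb R}$ is the (necessarily unique) hyperlimit of $(x_n)_n$ if $\forall q\in\mathbb N\,\exists M\in{}^{\sigma}\widetilde{\mathbb N}\,\forall n\in{}^{\sigma}\widetilde{\mathbb N},\ n\ge M:\ |x_n-l|<\mathrm d\rho^q$. *)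

theory Defs
  imports Complex_Main "HOL-Algebra.QuotRing" "HOL-Library.FuncSet"
begin

text \<open>
  A net is an element of \<open>{0<..1} \<rightarrow>\<^sub>E UNIV\<close>, so nets that agree on the index set \<open>{0<..1}\<close> are equal.
\<close>

definition gauge_net :: "(real \<Rightarrow> real) \<Rightarrow> bool" where
  "gauge_net \<rho> \<longleftrightarrow> \<rho> \<in> {0<..1} \<rightarrow>\<^sub>E {0<..1} \<and> (\<rho> \<longlongrightarrow> 0) (at_right 0)"

definition for_small :: "(real \<Rightarrow> bool) \<Rightarrow> bool" (binder \<open>\<forall>\<^sup>0\<close> 10) where
  "(\<forall>\<^sup>0\<epsilon>. P \<epsilon>) \<longleftrightarrow> (\<exists>\<epsilon>\<^sub>0\<in>{0<..1}. \<forall>\<epsilon>\<in>{0<..\<epsilon>\<^sub>0}. P \<epsilon>)"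

definition moderate_nets :: "(real \<Rightarrow> real) \<Rightarrow> (real \<Rightarrow> real) set" where
  "moderate_nets \<rho> =
     {x \<in> {0<..1} \<rightarrow>\<^sub>E UNIV. \<exists>N::nat. \<forall>\<^sup>0\<epsilon>. \<bar>x \<epsilon>\<bar> \<le> inverse (\<rho> \<epsilon> ^ N)}"

definition net_equiv :: "(real \<Rightarrow> real) \<Rightarrow> (real \<Rightarrow> real) \<Rightarrow> (real \<Rightarrow> real) \<Rightarrow> bool" where
  "net_equiv \<rho> x y \<longleftrightarrow> (\<forall>n::nat. \<forall>\<^sup>0\<epsilon>. \<bar>x \<epsilon> - y \<epsilon>\<bar> \<le> \<rho> \<epsilon> ^ n)"

definition negligible_nets :: "(real \<Rightarrow> real) \<Rightarrow> (real \<Rightarrow> real) set" where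
  "negligible_nets \<rho> = {z \<in> {0<..1} \<rightarrow>\<^sub>E UNIV. net_equiv \<rho> z (\<lambda>\<epsilon>\<in>{0<..1}. 0)}"

definition moderate_ring :: "(real \<Rightarrow> real) \<Rightarrow> (real \<Rightarrow> real) ring" where
  "moderate_ring \<rho> =
     \<lparr>carrier = moderate_nets \<rho>,
      mult = (\<lambda>x y. \<lambda>\<epsilon>\<in>{0<..1}. x \<epsilon> * y \<epsilon>), one = (\<lambda>\<epsilon>\<in>{0<..1}. 1),
      zero = (\<lambda>\<epsilon>\<in>{0<..1}. 0), add = (\<lambda>x y. \<lambda>\<epsilon>\<in>{0<..1}. x \<epsilon> + y \<epsilon>)\<rparr>"

text \<open>
  The negligible nets form an ideal whose cosets are exactly the classes of \<open>net_equiv\<close>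
  (lemmas \<open>ideal_negligible\<close> and \<open>net_class_eq_coset\<close> below), so the quotient by the
  equivalence relation is the quotient by this ideal.
\<close>

definition gen_ring :: "(real \<Rightarrow> real) \<Rightarrow> (real \<Rightarrow> real) set ring" where
  "gen_ring \<rho> = moderate_ring \<rho> Quot negligible_nets \<rho>"

definition net_class :: "(real \<Rightarrow> real) \<Rightarrow> (real \<Rightarrow> real) \<Rightarrow> (real \<Rightarrow> real) set" where
  "net_class \<rho> x = {y \<in> moderate_nets \<rho>. net_equiv \<rho> x y}"

text \<open>
  Independence of the representatives in the next two definitions is shown in lemmas
  \<open>gen_le_net_class\<close> and \<open>gen_abs_net_class\<close> below.
\<close>

definition gen_le :: "(real \<Rightarrow> real) \<Rightarrow> (real \<Rightarrow> real) set \<Rightarrow> (real \<Rightarrow> real) set \<Rightarrow> bool" where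
  "gen_le \<rho> X Y \<longleftrightarrow>
     (\<exists>x\<in>X. \<exists>y\<in>Y. \<exists>z\<in>negligible_nets \<rho>. \<forall>\<^sup>0\<epsilon>. x \<epsilon> \<le> y \<epsilon> + z \<epsilon>)"

definition gen_abs :: "(real \<Rightarrow> real) \<Rightarrow> (real \<Rightarrow> real) set \<Rightarrow> (real \<Rightarrow> real) set" where
  "gen_abs \<rho> X = (\<Union>x\<in>X. net_class \<rho> (\<lambda>\<epsilon>\<in>{0<..1}. \<bar>x \<epsilon>\<bar>))"

definition gen_less :: "(real \<Rightarrow> real) \<Rightarrow> (real \<Rightarrow> real) set \<Rightarrow> (real \<Rightarrow> real) set \<Rightarrow> bool" where
  "gen_less \<rho> X Y \<longleftrightarrow> gen_le \<rho> X Y \<and> Y \<ominus>\<^bsub>gen_ring \<rho>\<^esub> X \<in> Units (gen_ring \<rho>)"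

definition hypernat :: "(real \<Rightarrow> real) \<Rightarrow> (real \<Rightarrow> real) set set" where
  "hypernat \<sigma> = {net_class \<sigma> n | n. n \<in> moderate_nets \<sigma> \<and> (\<forall>\<epsilon>\<in>{0<..1}. n \<epsilon> \<in> \<nat>)}"

definition has_hyperlimit ::
  "(real \<Rightarrow> real) \<Rightarrow> (real \<Rightarrow> real) \<Rightarrow> ((real \<Rightarrow> real) set \<Rightarrow> (real \<Rightarrow> real) set)
    \<Rightarrow> (real \<Rightarrow> real) set \<Rightarrow> bool" where
  "has_hyperlimit \<sigma> \<rho> x l \<longleftrightarrow>
     l \<in> carrier (gen_ring \<rho>) \<and>
     (\<forall>q::nat. \<exists>M\<in>hypernat \<sigma>. \<forall>n\<in>hypernat \<sigma>. gen_le \<sigma> M n \<longrightarrow>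
        gen_less \<rho> (gen_abs \<rho> (x n \<ominus>\<^bsub>gen_ring \<rho>\<^esub> l)) (net_class \<rho> \<rho> [^]\<^bsub>gen_ring \<rho>\<^esub> q))"


lemma for_small_iff_eventually: "(\<forall>\<^sup>0\<epsilon>. P \<epsilon>) \<longleftrightarrow> eventually P (at_right 0)"
proof
  assume "\<forall>\<^sup>0\<epsilon>. P \<epsilon>"
  then obtain e where "0 < e" "\<forall>\<epsilon>\<in>{0<..e}. P \<epsilon>"
    by (auto simp: for_small_def)
  then show "eventually P (at_right 0)"
    by (auto simp: eventually_at_right_field intro!: exI[of _ e])
next
  assume "eventually P (at_right 0)"
  then obtain b where "0 < b" "\<forall>y>0. y < b \<longrightarrow> P y"
    by (auto simp: eventually_at_right_field)
  then show "\<forall>\<^sup>0\<epsilon>. P \<epsilon>"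
    unfolding for_small_def by (intro bexI[of _ "min 1 (b / 2)"]) auto
qed

lemma for_small_conj: "(\<forall>\<^sup>0\<epsilon>. P \<epsilon>) \<Longrightarrow> (\<forall>\<^sup>0\<epsilon>. Q \<epsilon>) \<Longrightarrow> (\<forall>\<^sup>0\<epsilon>. P \<epsilon> \<and> Q \<epsilon>)"
  by (simp add: for_small_iff_eventually eventually_conj)

lemma for_small_mono:
  "(\<forall>\<^sup>0\<epsilon>. P \<epsilon>) \<Longrightarrow> (\<And>\<epsilon>. 0 < \<epsilon> \<Longrightarrow> \<epsilon> \<le> 1 \<Longrightarrow> P \<epsilon> \<Longrightarrow> Q \<epsilon>) \<Longrightarrow> (\<forall>\<^sup>0\<epsilon>. Q \<epsilon>)"
  unfolding for_small_def by force

lemma for_small_all: "(\<And>\<epsilon>. 0 < \<epsilon> \<Longrightarrow> \<epsilon> \<le> 1 \<Longrightarrow> Q \<epsilon>) \<Longrightarrow> (\<forall>\<^sup>0\<epsilon>. Q \<epsilon>)"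
  unfolding for_small_def by force

lemma net_equiv_sym: "net_equiv \<rho> x y \<Longrightarrow> net_equiv \<rho> y x"
  by (simp add: net_equiv_def abs_minus_commute)

context
  fixes \<rho> assumes gauge: "gauge_net \<rho>"
begin

lemma gauge_pos: "0 < \<epsilon> \<Longrightarrow> \<epsilon> \<le> 1 \<Longrightarrow> 0 < \<rho> \<epsilon>" "0 < \<epsilon> \<Longrightarrow> \<epsilon> \<le> 1 \<Longrightarrow> \<rho> \<epsilon> \<le> 1"
  using gauge by (auto simp: gauge_net_def PiE_def Pi_def)

lemma gauge_less_half: "\<forall>\<^sup>0\<epsilon>. \<rho> \<epsilon> \<le> 1 / 2"
proof -
  have "(\<rho> \<longlongrightarrow> 0) (at_right 0)" using gauge by (simp add: gauge_net_def)
  then have "\<forall>\<^sub>F \<epsilon> in at_right 0. \<rho> \<epsilon> < 1 / 2" by (rule order_tendstoD) simp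
  then show ?thesis unfolding for_small_iff_eventually by (rule eventually_mono) simp
qed

lemma net_equiv_refl: "net_equiv \<rho> x x"
  unfolding net_equiv_def by (intro allI for_small_all) (auto dest: gauge_pos(1))

lemma net_equiv_add:
  assumes "net_equiv \<rho> x y" "net_equiv \<rho> u v"
    and le: "\<And>\<epsilon>. 0 < \<epsilon> \<Longrightarrow> \<epsilon> \<le> 1 \<Longrightarrow> \<bar>a \<epsilon> - b \<epsilon>\<bar> \<le> \<bar>x \<epsilon> - y \<epsilon>\<bar> + \<bar>u \<epsilon> - v \<epsilon>\<bar>"
  shows "net_equiv \<rho> a b"
  unfolding net_equiv_def
proof
  fix n
  have 1: "\<forall>\<^sup>0\<epsilon>. \<bar>x \<epsilon> - y \<epsilon>\<bar> \<le> \<rho> \<epsilon> ^ Suc n" "\<forall>\<^sup>0\<epsilon>. \<bar>u \<epsilon> - v \<epsilon>\<bar> \<le> \<rho> \<epsilon> ^ Suc n"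
    using assms unfolding net_equiv_def by blast+
  show "\<forall>\<^sup>0\<epsilon>. \<bar>a \<epsilon> - b \<epsilon>\<bar> \<le> \<rho> \<epsilon> ^ n"
  proof (rule for_small_mono[OF for_small_conj[OF for_small_conj[OF 1] gauge_less_half]])
    fix \<epsilon> :: real assume e: "0 < \<epsilon>" "\<epsilon> \<le> 1"
      and h: "(\<bar>x \<epsilon> - y \<epsilon>\<bar> \<le> \<rho> \<epsilon> ^ Suc n \<and> \<bar>u \<epsilon> - v \<epsilon>\<bar> \<le> \<rho> \<epsilon> ^ Suc n) \<and> \<rho> \<epsilon> \<le> 1 / 2"
    have "\<rho> \<epsilon> * \<rho> \<epsilon> ^ n \<le> 1 / 2 * \<rho> \<epsilon> ^ n"
      using h gauge_pos[OF e] by (intro mult_right_mono) auto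
    then show "\<bar>a \<epsilon> - b \<epsilon>\<bar> \<le> \<rho> \<epsilon> ^ n"
      using h le[OF e] by simp
  qed
qed

lemma net_equiv_mono:
  assumes "net_equiv \<rho> x y"
    and "\<And>\<epsilon>. 0 < \<epsilon> \<Longrightarrow> \<epsilon> \<le> 1 \<Longrightarrow> \<bar>a \<epsilon> - b \<epsilon>\<bar> \<le> \<bar>x \<epsilon> - y \<epsilon>\<bar>"
  shows "net_equiv \<rho> a b"
  using net_equiv_add[OF assms(1) net_equiv_refl] assms(2) by simp

lemma net_equiv_trans: "net_equiv \<rho> x y \<Longrightarrow> net_equiv \<rho> y z \<Longrightarrow> net_equiv \<rho> x z"
  by (erule (1) net_equiv_add) auto

lemma moderateE:
  assumes "x \<in> moderate_nets \<rho>"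
  obtains N :: nat where "\<forall>\<^sup>0\<epsilon>. \<bar>x \<epsilon>\<bar> \<le> inverse (\<rho> \<epsilon> ^ N)"
  using assms unfolding moderate_nets_def by blast

lemma moderate_bound:
  assumes "x \<in> moderate_nets \<rho>" "y \<in> moderate_nets \<rho>" "a \<in> {0<..1} \<rightarrow>\<^sub>E UNIV"
    and le: "\<And>\<epsilon>. 0 < \<epsilon> \<Longrightarrow> \<epsilon> \<le> 1 \<Longrightarrow>
      \<bar>a \<epsilon>\<bar> \<le> \<bar>x \<epsilon>\<bar> + \<bar>y \<epsilon>\<bar> \<or> \<bar>a \<epsilon>\<bar> \<le> \<bar>x \<epsilon>\<bar> * \<bar>y \<epsilon>\<bar>"
  shows "a \<in> moderate_nets \<rho>"
proof -
  obtain N M :: nat where NM: "\<forall>\<^sup>0\<epsilon>. \<bar>x \<epsilon>\<bar> \<le> inverse (\<rho> \<epsilon> ^ N)" "\<forall>\<^sup>0\<epsilon>. \<bar>y \<epsilon>\<bar> \<le> inverse (\<rho> \<epsilon> ^ M)"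
    using assms by (metis moderateE)
  have "\<forall>\<^sup>0\<epsilon>. \<bar>a \<epsilon>\<bar> \<le> inverse (\<rho> \<epsilon> ^ (N + M + 1))"
  proof (rule for_small_mono[OF for_small_conj[OF for_small_conj[OF NM] gauge_less_half]])
    fix \<epsilon> :: real assume e: "0 < \<epsilon>" "\<epsilon> \<le> 1"
      and h: "(\<bar>x \<epsilon>\<bar> \<le> inverse (\<rho> \<epsilon> ^ N) \<and> \<bar>y \<epsilon>\<bar> \<le> inverse (\<rho> \<epsilon> ^ M)) \<and> \<rho> \<epsilon> \<le> 1 / 2"
    define A B r where "A = inverse (\<rho> \<epsilon> ^ N)" "B = inverse (\<rho> \<epsilon> ^ M)" "r = inverse (\<rho> \<epsilon>)"
    have "\<rho> \<epsilon> ^ N \<le> 1" "\<rho> \<epsilon> ^ M \<le> 1" using gauge_pos[OF e] by (auto intro: power_le_one)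
    then have AB: "A \<ge> 1" "B \<ge> 1" using gauge_pos[OF e] by (auto simp: A_B_r_def one_le_inverse_iff)
    have r: "r \<ge> 2" using h gauge_pos[OF e] by (auto simp: A_B_r_def field_simps)
    have "0 \<le> (A - 1) * (B - 1)" using AB by (intro mult_nonneg_nonneg) auto
    moreover have "A * B \<ge> 1" using AB mult_mono[of 1 A 1 B] by simp
    ultimately have 1: "A + B \<le> 2 * (A * B)" by (simp add: algebra_simps)
    have 2: "2 * (A * B) \<le> r * (A * B)" using r \<open>A * B \<ge> 1\<close> by (intro mult_right_mono) auto
    have 3: "\<bar>x \<epsilon>\<bar> * \<bar>y \<epsilon>\<bar> \<le> A * B" using h AB by (intro mult_mono) (auto simp flip: A_B_r_def)
    have "\<bar>x \<epsilon>\<bar> + \<bar>y \<epsilon>\<bar> \<le> A + B" using h by (simp add: A_B_r_def)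
    then have "\<bar>a \<epsilon>\<bar> \<le> r * (A * B)" using le[OF e] 1 2 3 \<open>A * B \<ge> 1\<close> by linarith
    then show "\<bar>a \<epsilon>\<bar> \<le> inverse (\<rho> \<epsilon> ^ (N + M + 1))"
      by (simp add: A_B_r_def power_add ac_simps)
  qed
  then show ?thesis using assms(3) unfolding moderate_nets_def by blast
qed

lemma moderate_const: "(\<lambda>\<epsilon>\<in>{0<..1}. c) \<in> moderate_nets \<rho>" if "\<bar>c\<bar> \<le> 1"
  using that unfolding moderate_nets_def
  by (auto intro!: exI[of _ 0] for_small_all)

lemma negligible_moderate: "z \<in> negligible_nets \<rho> \<Longrightarrow> z \<in> moderate_nets \<rho>"
proof -
  assume z: "z \<in> negligible_nets \<rho>"
  then have "\<forall>\<^sup>0\<epsilon>. \<bar>z \<epsilon> - (\<lambda>\<epsilon>\<in>{0<..1}. 0) \<epsilon>\<bar> \<le> \<rho> \<epsilon> ^ 0"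
    unfolding negligible_nets_def net_equiv_def by blast
  then have "\<forall>\<^sup>0\<epsilon>. \<bar>z \<epsilon>\<bar> \<le> inverse (\<rho> \<epsilon> ^ 0)" by (rule for_small_mono) simp
  then show ?thesis using z unfolding moderate_nets_def negligible_nets_def by blast
qed

lemma cring_moderate: "cring (moderate_ring \<rho>)"
proof -
  have mod_ext: "x \<in> extensional {0<..1}" if "x \<in> moderate_nets \<rho>" for x
    using that by (auto simp: moderate_nets_def PiE_def)
  have add: "(\<lambda>\<epsilon>\<in>{0<..1}. x \<epsilon> + y \<epsilon>) \<in> moderate_nets \<rho>"
    and mult: "(\<lambda>\<epsilon>\<in>{0<..1}. x \<epsilon> * y \<epsilon>) \<in> moderate_nets \<rho>"
    if "x \<in> moderate_nets \<rho>" "y \<in> moderate_nets \<rho>" for x y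
    using that by (auto intro!: moderate_bound[of x y] simp: abs_mult abs_triangle_ineq)
  have uminus: "(\<lambda>\<epsilon>\<in>{0<..1}. - x \<epsilon>) \<in> moderate_nets \<rho>" if "x \<in> moderate_nets \<rho>" for x
    using that by (auto intro!: moderate_bound[of x x])
  have "abelian_group (moderate_ring \<rho>)"
  proof (rule abelian_groupI)
    fix x assume "x \<in> carrier (moderate_ring \<rho>)"
    then show "\<exists>y\<in>carrier (moderate_ring \<rho>). y \<oplus>\<^bsub>moderate_ring \<rho>\<^esub> x = \<zero>\<^bsub>moderate_ring \<rho>\<^esub>"
      by (intro bexI[of _ "\<lambda>\<epsilon>\<in>{0<..1}. - x \<epsilon>"])
        (auto simp: moderate_ring_def uminus)
  qed (auto simp: moderate_ring_def add moderate_const mod_ext intro!: extensionalityI[where A = "{0<..1}"])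
  moreover have "comm_monoid (moderate_ring \<rho>)"
    by (rule comm_monoidI) (auto simp: moderate_ring_def mult moderate_const mod_ext intro!: extensionalityI[where A = "{0<..1}"])
  ultimately show ?thesis
    by (rule cringI) (auto simp: moderate_ring_def algebra_simps)
qed

lemma ideal_negligible: "ideal (negligible_nets \<rho>) (moderate_ring \<rho>)"
proof -
  interpret cring "moderate_ring \<rho>" by (rule cring_moderate)
  have mult: "(\<lambda>\<epsilon>\<in>{0<..1}. x \<epsilon> * z \<epsilon>) \<in> negligible_nets \<rho>"
    if z: "z \<in> negligible_nets \<rho>" and x: "x \<in> moderate_nets \<rho>" for x z
  proof -
    obtain N :: nat where N: "\<forall>\<^sup>0\<epsilon>. \<bar>x \<epsilon>\<bar> \<le> inverse (\<rho> \<epsilon> ^ N)" using x by (rule moderateE)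
    have "\<forall>\<^sup>0\<epsilon>. \<bar>(\<lambda>\<epsilon>\<in>{0<..1}. x \<epsilon> * z \<epsilon>) \<epsilon> - (\<lambda>\<epsilon>\<in>{0<..1}. 0) \<epsilon>\<bar> \<le> \<rho> \<epsilon> ^ n" for n
    proof -
      have "\<forall>\<^sup>0\<epsilon>. \<bar>z \<epsilon> - (\<lambda>\<epsilon>\<in>{0<..1}. 0) \<epsilon>\<bar> \<le> \<rho> \<epsilon> ^ (N + n)"
        using z unfolding negligible_nets_def net_equiv_def by blast
      from for_small_conj[OF this N] show ?thesis
      proof (rule for_small_mono)
        fix \<epsilon> :: real assume e: "0 < \<epsilon>" "\<epsilon> \<le> 1"
          and h: "\<bar>z \<epsilon> - (\<lambda>\<epsilon>\<in>{0<..1}. 0) \<epsilon>\<bar> \<le> \<rho> \<epsilon> ^ (N + n) \<and> \<bar>x \<epsilon>\<bar> \<le> inverse (\<rho> \<epsilon> ^ N)"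
        have "\<bar>x \<epsilon>\<bar> * \<bar>z \<epsilon>\<bar> \<le> inverse (\<rho> \<epsilon> ^ N) * \<rho> \<epsilon> ^ (N + n)"
          using h e gauge_pos[OF e] by (intro mult_mono) auto
        also have "\<dots> = \<rho> \<epsilon> ^ n" using gauge_pos[OF e] by (simp add: power_add)
        finally show "\<bar>(\<lambda>\<epsilon>\<in>{0<..1}. x \<epsilon> * z \<epsilon>) \<epsilon> - (\<lambda>\<epsilon>\<in>{0<..1}. 0) \<epsilon>\<bar> \<le> \<rho> \<epsilon> ^ n"
          using e by (simp add: abs_mult)
      qed
    qed
    then show ?thesis by (auto simp: negligible_nets_def net_equiv_def)
  qed
  show ?thesis
  proof (rule idealI[OF ring_axioms])
    show "subgroup (negligible_nets \<rho>) (add_monoid (moderate_ring \<rho>))"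
    proof (rule add.subgroupI)
      show "negligible_nets \<rho> \<subseteq> carrier (moderate_ring \<rho>)"
        using negligible_moderate by (auto simp: moderate_ring_def)
      show "negligible_nets \<rho> \<noteq> {}"
        using net_equiv_refl[of "\<lambda>\<epsilon>\<in>{0<..1}. 0"]
        by (auto simp: negligible_nets_def intro!: exI[of _ "\<lambda>\<epsilon>\<in>{0<..1}. 0"])
    next
      fix a assume a: "a \<in> negligible_nets \<rho>"
      have "\<ominus>\<^bsub>moderate_ring \<rho>\<^esub> a = (\<lambda>\<epsilon>\<in>{0<..1}. - a \<epsilon>)"
        by (rule minus_equality)
          (use negligible_moderate[OF a] moderate_bound[of a a "\<lambda>\<epsilon>\<in>{0<..1}. - a \<epsilon>"] in
            \<open>auto simp: moderate_ring_def intro!: restrict_ext\<close>)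
      also have "\<dots> = (\<lambda>\<epsilon>\<in>{0<..1}. (\<lambda>\<epsilon>\<in>{0<..1}. -1) \<epsilon> * a \<epsilon>)"
        by (rule restrict_ext) simp
      finally show "\<ominus>\<^bsub>moderate_ring \<rho>\<^esub> a \<in> negligible_nets \<rho>"
        using mult[OF a moderate_const[of "-1"]] by simp
    next
      fix a b assume ab: "a \<in> negligible_nets \<rho>" "b \<in> negligible_nets \<rho>"
      then have "net_equiv \<rho> a (\<lambda>\<epsilon>\<in>{0<..1}. 0)" "net_equiv \<rho> b (\<lambda>\<epsilon>\<in>{0<..1}. 0)"
        by (auto simp: negligible_nets_def)
      then have "net_equiv \<rho> (\<lambda>\<epsilon>\<in>{0<..1}. a \<epsilon> + b \<epsilon>) (\<lambda>\<epsilon>\<in>{0<..1}. 0)"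
        by (rule net_equiv_add) auto
      then show "a \<oplus>\<^bsub>moderate_ring \<rho>\<^esub> b \<in> negligible_nets \<rho>"
        by (simp add: moderate_ring_def negligible_nets_def)
    qed
  next
    fix a x assume ax: "a \<in> negligible_nets \<rho>" "x \<in> carrier (moderate_ring \<rho>)"
    then show "x \<otimes>\<^bsub>moderate_ring \<rho>\<^esub> a \<in> negligible_nets \<rho>"
      using mult by (simp add: moderate_ring_def)
    then show "a \<otimes>\<^bsub>moderate_ring \<rho>\<^esub> x \<in> negligible_nets \<rho>"
      by (simp add: moderate_ring_def mult.commute)
  qed
qed

lemma cring_gen_ring: "cring (gen_ring \<rho>)"
  unfolding gen_ring_def
  by (rule ideal.quotient_is_cring[OF ideal_negligible cring_moderate])

lemma net_class_eq_coset:
  assumes x: "x \<in> moderate_nets \<rho>"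
  shows "net_class \<rho> x = negligible_nets \<rho> +>\<^bsub>moderate_ring \<rho>\<^esub> x"
proof (intro equalityI subsetI)
  fix y assume y: "y \<in> net_class \<rho> x"
  then have y': "y \<in> moderate_nets \<rho>" "net_equiv \<rho> x y" by (auto simp: net_class_def)
  let ?z = "\<lambda>\<epsilon>\<in>{0<..1}. y \<epsilon> - x \<epsilon>"
  have "?z \<in> negligible_nets \<rho>"
    using net_equiv_mono[OF y'(2), of ?z "\<lambda>\<epsilon>\<in>{0<..1}. 0"] by (auto simp: negligible_nets_def)
  moreover have "y = ?z \<oplus>\<^bsub>moderate_ring \<rho>\<^esub> x"
    using y' by (auto simp: moderate_ring_def moderate_nets_def intro!: PiE_ext[of y])
  ultimately show "y \<in> negligible_nets \<rho> +>\<^bsub>moderate_ring \<rho>\<^esub> x"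
    by (auto simp: a_r_coset_def')
next
  fix y assume "y \<in> negligible_nets \<rho> +>\<^bsub>moderate_ring \<rho>\<^esub> x"
  then obtain z where z: "z \<in> negligible_nets \<rho>" "y = (\<lambda>\<epsilon>\<in>{0<..1}. z \<epsilon> + x \<epsilon>)"
    by (auto simp: a_r_coset_def' moderate_ring_def)
  have "y \<in> moderate_nets \<rho>"
    using z by (auto intro!: moderate_bound[OF negligible_moderate x, of z])
  moreover have "net_equiv \<rho> z (\<lambda>\<epsilon>\<in>{0<..1}. 0)" using z by (simp add: negligible_nets_def)
  then have "net_equiv \<rho> x y" by (rule net_equiv_mono) (simp add: z)
  ultimately show "y \<in> net_class \<rho> x" by (simp add: net_class_def)
qed

lemma carrier_gen_ring: "carrier (gen_ring \<rho>) = net_class \<rho> ` moderate_nets \<rho>"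
  using net_class_eq_coset
  by (auto simp: gen_ring_def FactRing_def A_RCOSETS_def' moderate_ring_def)

lemma net_class_eq_iff:
  assumes "x \<in> moderate_nets \<rho>" "y \<in> moderate_nets \<rho>"
  shows "net_class \<rho> x = net_class \<rho> y \<longleftrightarrow> net_equiv \<rho> x y"
  using assms net_equiv_refl net_equiv_trans net_equiv_sym unfolding net_class_def by blast

lemma gen_le_net_class:
  assumes "x \<in> moderate_nets \<rho>" "y \<in> moderate_nets \<rho>"
  shows "gen_le \<rho> (net_class \<rho> x) (net_class \<rho> y) \<longleftrightarrow>
    (\<exists>z\<in>negligible_nets \<rho>. \<forall>\<^sup>0\<epsilon>. x \<epsilon> \<le> y \<epsilon> + z \<epsilon>)"
proof
  assume "gen_le \<rho> (net_class \<rho> x) (net_class \<rho> y)"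
  then obtain u v z where h: "net_equiv \<rho> x u" "net_equiv \<rho> y v" "z \<in> negligible_nets \<rho>"
    "\<forall>\<^sup>0\<epsilon>. u \<epsilon> \<le> v \<epsilon> + z \<epsilon>"
    by (auto simp: gen_le_def net_class_def)
  define w where "w = (\<lambda>\<epsilon>\<in>{0<..1}. \<bar>x \<epsilon> - u \<epsilon>\<bar> + \<bar>y \<epsilon> - v \<epsilon>\<bar>)"
  have "net_equiv \<rho> w (\<lambda>\<epsilon>\<in>{0<..1}. 0)"
    by (rule net_equiv_add[OF h(1,2)]) (simp add: w_def)
  moreover have "net_equiv \<rho> z (\<lambda>\<epsilon>\<in>{0<..1}. 0)" using h(3) by (simp add: negligible_nets_def)
  ultimately have "net_equiv \<rho> (\<lambda>\<epsilon>\<in>{0<..1}. w \<epsilon> + z \<epsilon>) (\<lambda>\<epsilon>\<in>{0<..1}. 0)"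
    by (rule net_equiv_add) auto
  then have "(\<lambda>\<epsilon>\<in>{0<..1}. w \<epsilon> + z \<epsilon>) \<in> negligible_nets \<rho>" by (simp add: negligible_nets_def)
  moreover have "\<forall>\<^sup>0\<epsilon>. x \<epsilon> \<le> y \<epsilon> + (\<lambda>\<epsilon>\<in>{0<..1}. w \<epsilon> + z \<epsilon>) \<epsilon>"
    using h(4) by (rule for_small_mono) (auto simp: w_def)
  ultimately show "\<exists>z\<in>negligible_nets \<rho>. \<forall>\<^sup>0\<epsilon>. x \<epsilon> \<le> y \<epsilon> + z \<epsilon>" by blast
next
  assume "\<exists>z\<in>negligible_nets \<rho>. \<forall>\<^sup>0\<epsilon>. x \<epsilon> \<le> y \<epsilon> + z \<epsilon>"
  then show "gen_le \<rho> (net_class \<rho> x) (net_class \<rho> y)"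
    using assms net_equiv_refl unfolding gen_le_def net_class_def by blast
qed

lemma gen_abs_net_class:
  assumes x: "x \<in> moderate_nets \<rho>"
  shows "gen_abs \<rho> (net_class \<rho> x) = net_class \<rho> (\<lambda>\<epsilon>\<in>{0<..1}. \<bar>x \<epsilon>\<bar>)"
proof -
  have mod: "(\<lambda>\<epsilon>\<in>{0<..1}. \<bar>u \<epsilon>\<bar>) \<in> moderate_nets \<rho>" if "u \<in> moderate_nets \<rho>" for u
    using that by (auto intro!: moderate_bound[of u u])
  have "net_class \<rho> (\<lambda>\<epsilon>\<in>{0<..1}. \<bar>u \<epsilon>\<bar>) = net_class \<rho> (\<lambda>\<epsilon>\<in>{0<..1}. \<bar>x \<epsilon>\<bar>)"
    if u: "u \<in> net_class \<rho> x" for u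
  proof -
    have "net_equiv \<rho> x u" "u \<in> moderate_nets \<rho>" using u by (auto simp: net_class_def)
    moreover from this(1) have "net_equiv \<rho> (\<lambda>\<epsilon>\<in>{0<..1}. \<bar>u \<epsilon>\<bar>) (\<lambda>\<epsilon>\<in>{0<..1}. \<bar>x \<epsilon>\<bar>)"
      by (rule net_equiv_mono) auto
    ultimately show ?thesis using net_class_eq_iff mod x by blast
  qed
  moreover have "x \<in> net_class \<rho> x" using x net_equiv_refl by (simp add: net_class_def)
  ultimately show ?thesis unfolding gen_abs_def by blast
qed

end

end

theory Submission
  imports Defs
begin

text \<open>
  On representatives, \<open>[x\<^sub>\<epsilon>] < [y\<^sub>\<epsilon>]\<close> means that \<open>y\<^sub>\<epsilon> - x\<^sub>\<epsilon>\<close> is eventually bounded below by a power of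
  \<open>\<rho>\<^sub>\<epsilon>\<close>, and hyperconvergence means that \<open>\<bar>x\<^sub>\<epsilon> - l\<^sub>\<epsilon>\<bar>\<close> is eventually at most \<open>\<rho>\<^sub>\<epsilon>\<^sup>q\<close>.
  Both claims then become classical \<open>\<epsilon>\<close>-wise estimates, in which a constant factor is absorbed by one
  further power of \<open>\<rho>\<^sub>\<epsilon> \<le> 1/2\<close>; for two hypersequences one passes to the \<open>\<epsilon>\<close>-wise maximum of the
  two thresholds.
\<close>

section \<open>Estimates for small \<epsilon> and moderate nets\<close>

lemma for_small_elim2:
  assumes "\<forall>\<^sup>0\<epsilon>. P \<epsilon>" "\<forall>\<^sup>0\<epsilon>. Q \<epsilon>"
    and "\<And>\<epsilon>. 0 < \<epsilon> \<Longrightarrow> \<epsilon> \<le> 1 \<Longrightarrow> P \<epsilon> \<Longrightarrow> Q \<epsilon> \<Longrightarrow> R \<epsilon>"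
  shows "\<forall>\<^sup>0\<epsilon>. R \<epsilon>"
  using for_small_mono[OF for_small_conj[OF assms(1,2)]] assms(3) by blast

lemma extensional_moderate: "x \<in> moderate_nets \<rho> \<Longrightarrow> x \<in> extensional {0<..1}"
  by (auto simp: moderate_nets_def PiE_def)

context
  fixes \<rho> :: "real \<Rightarrow> real"
  assumes gauge: "gauge_net \<rho>"
begin

text \<open>The exponent is quantified inside, because the single condition \<rho> \<le> 1/2 serves
  all exponents at once. One application can therefore be instantiated at several exponents for the
  same \<epsilon>.\<close>

lemma gauge_half_power: "\<forall>\<^sup>0\<epsilon>. \<forall>n. 2 * \<rho> \<epsilon> ^ Suc n \<le> \<rho> \<epsilon> ^ n"
proof (rule for_small_mono[OF gauge_less_half[OF gauge]], rule allI)
  fix \<epsilon> :: real and n :: nat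
  assume e: "0 < \<epsilon>" "\<epsilon> \<le> 1" and h: "\<rho> \<epsilon> \<le> 1 / 2"
  have "\<rho> \<epsilon> * \<rho> \<epsilon> ^ n \<le> 1 / 2 * \<rho> \<epsilon> ^ n"
    using h gauge_pos[OF gauge e] by (intro mult_right_mono) auto
  then show "2 * \<rho> \<epsilon> ^ Suc n \<le> \<rho> \<epsilon> ^ n" by simp
qed

text \<open>Serves the pointwise inverse below, which inverts a net only for small
  \<epsilon>.\<close>

lemma eventually_equiv_imp_net_equiv:
  assumes "\<forall>\<^sup>0\<epsilon>. x \<epsilon> = y \<epsilon>"
  shows "net_equiv \<rho> x y"
  unfolding net_equiv_def
proof
  fix n
  from assms show "\<forall>\<^sup>0\<epsilon>. \<bar>x \<epsilon> - y \<epsilon>\<bar> \<le> \<rho> \<epsilon> ^ n"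
    by (rule for_small_mono) (use gauge_pos(1)[OF gauge] in \<open>auto intro: less_imp_le\<close>)
qed

lemma moderate_diff:
  "x \<in> moderate_nets \<rho> \<Longrightarrow> y \<in> moderate_nets \<rho> \<Longrightarrow> (\<lambda>\<epsilon>\<in>{0<..1}. x \<epsilon> - y \<epsilon>) \<in> moderate_nets \<rho>"
  by (rule moderate_bound[OF gauge, of x y]) auto

lemma moderate_abs: "x \<in> moderate_nets \<rho> \<Longrightarrow> (\<lambda>\<epsilon>\<in>{0<..1}. \<bar>x \<epsilon>\<bar>) \<in> moderate_nets \<rho>"
  by (rule moderate_bound[OF gauge, of x x]) auto

lemma moderate_gauge_power: "(\<lambda>\<epsilon>\<in>{0<..1}. \<rho> \<epsilon> ^ q) \<in> moderate_nets \<rho>"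
  by (rule moderate_bound[OF gauge moderate_const[OF gauge, of 1] moderate_const[OF gauge, of 1]])
    (use gauge_pos[OF gauge] in \<open>auto intro!: power_le_one simp: less_imp_le\<close>)

section \<open>Ring operations and units of the quotient, computed on representatives\<close>

text \<open>On moderate nets \<open>net_class\<close> is the coset projection, so the laws of a
  quotient homomorphism carry over. This is the bridge by which every operation of
  \<open>gen_ring\<close> is reduced to a pointwise one.\<close>

lemma net_class_ring_hom: "ring_hom_cring (moderate_ring \<rho>) (gen_ring \<rho>) (net_class \<rho>)"
proof (intro ring_hom_cring.intro ring_hom_cring_axioms.intro cring_moderate[OF gauge] cring_gen_ring[OF gauge])
  interpret ideal "negligible_nets \<rho>" "moderate_ring \<rho>" by (rule ideal_negligible[OF gauge])
  have eq: "net_class \<rho> x = negligible_nets \<rho> +>\<^bsub>moderate_ring \<rho>\<^esub> x"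
    if "x \<in> carrier (moderate_ring \<rho>)" for x
    using net_class_eq_coset[OF gauge] that by (simp add: moderate_ring_def)
  show "net_class \<rho> \<in> ring_hom (moderate_ring \<rho>) (gen_ring \<rho>)"
    using rcos_ring_hom unfolding gen_ring_def[symmetric] ring_hom_def
    by (auto simp: eq Pi_iff)
qed

lemma net_class_diff:
  assumes x: "x \<in> moderate_nets \<rho>" and y: "y \<in> moderate_nets \<rho>"
  shows "net_class \<rho> x \<ominus>\<^bsub>gen_ring \<rho>\<^esub> net_class \<rho> y = net_class \<rho> (\<lambda>\<epsilon>\<in>{0<..1}. x \<epsilon> - y \<epsilon>)"
proof -
  interpret ring_hom_cring "moderate_ring \<rho>" "gen_ring \<rho>" "net_class \<rho>" by (rule net_class_ring_hom)
  let ?d = "\<lambda>\<epsilon>\<in>{0<..1}. x \<epsilon> - y \<epsilon>"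
  have car: "x \<in> carrier (moderate_ring \<rho>)" "y \<in> carrier (moderate_ring \<rho>)" "?d \<in> carrier (moderate_ring \<rho>)"
    using x y moderate_diff by (auto simp: moderate_ring_def)
  \<comment> \<open>Additivity of the projection is applied to this sum and then cancelled in the
    quotient, which avoids computing additive inverses of nets.\<close>
  have "x = ?d \<oplus>\<^bsub>moderate_ring \<rho>\<^esub> y"
    using extensional_moderate[OF x]
    by (auto simp: moderate_ring_def intro!: extensionalityI[where A = "{0<..1}"])
  then have "net_class \<rho> x = net_class \<rho> ?d \<oplus>\<^bsub>gen_ring \<rho>\<^esub> net_class \<rho> y"
    using hom_add[OF car(3,2)] by simp
  then show ?thesis
    using hom_closed[OF car(2)] hom_closed[OF car(3)]
    by (simp add: S.minus_eq S.a_assoc S.r_neg)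
qed

lemma net_class_gauge_power:
  "net_class \<rho> \<rho> [^]\<^bsub>gen_ring \<rho>\<^esub> (q::nat) = net_class \<rho> (\<lambda>\<epsilon>\<in>{0<..1}. \<rho> \<epsilon> ^ q)"
proof -
  interpret ring_hom_cring "moderate_ring \<rho>" "gen_ring \<rho>" "net_class \<rho>" by (rule net_class_ring_hom)
  \<comment> \<open>Extensionality identifies the gauge with its restricted first power, and so
    makes it moderate.\<close>
  have "\<rho> \<in> extensional {0<..1}" using gauge by (auto simp: gauge_net_def PiE_def)
  then have "(\<lambda>\<epsilon>\<in>{0<..1}. \<rho> \<epsilon> ^ 1) = \<rho>" by (simp add: extensional_restrict)
  then have car: "\<rho> \<in> carrier (moderate_ring \<rho>)"
    using moderate_gauge_power[of 1] by (simp add: moderate_ring_def)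
  show ?thesis
  proof (induction q)
    case 0
    then show ?case using hom_one by (simp add: moderate_ring_def del: restrict_apply)
  next
    case (Suc q)
    have "(\<lambda>\<epsilon>\<in>{0<..1}. \<rho> \<epsilon> ^ q) \<otimes>\<^bsub>moderate_ring \<rho>\<^esub> \<rho> = (\<lambda>\<epsilon>\<in>{0<..1}. \<rho> \<epsilon> ^ Suc q)"
      by (auto simp: moderate_ring_def mult.commute intro!: restrict_ext)
    moreover have "(\<lambda>\<epsilon>\<in>{0<..1}. \<rho> \<epsilon> ^ q) \<in> carrier (moderate_ring \<rho>)"
      using moderate_gauge_power by (simp add: moderate_ring_def)
    ultimately show ?case using Suc hom_mult[OF _ car] by (metis S.nat_pow_Suc)
  qed
qed

text \<open>If u inverts x up to equivalence, then |u x| stays away from 0 while u is moderate, so x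
  cannot fall below some power of \<rho>. Conversely, such a lower bound on |x| is exactly an upper
  bound for the moderateness of 1/x.\<close>

lemma net_class_Units_iff:
  assumes x: "x \<in> moderate_nets \<rho>"
  shows "net_class \<rho> x \<in> Units (gen_ring \<rho>) \<longleftrightarrow> (\<exists>m. \<forall>\<^sup>0\<epsilon>. \<rho> \<epsilon> ^ m \<le> \<bar>x \<epsilon>\<bar>)"
proof -
  interpret ring_hom_cring "moderate_ring \<rho>" "gen_ring \<rho>" "net_class \<rho>" by (rule net_class_ring_hom)
  let ?one = "\<lambda>\<epsilon>\<in>{0<..1}. 1 :: real"
  have prod: "net_class \<rho> u \<otimes>\<^bsub>gen_ring \<rho>\<^esub> net_class \<rho> x = \<one>\<^bsub>gen_ring \<rho>\<^esub>
      \<longleftrightarrow> net_equiv \<rho> (\<lambda>\<epsilon>\<in>{0<..1}. u \<epsilon> * x \<epsilon>) ?one" if u: "u \<in> moderate_nets \<rho>" for u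
  proof -
    have ux: "(\<lambda>\<epsilon>\<in>{0<..1}. u \<epsilon> * x \<epsilon>) \<in> moderate_nets \<rho>"
      by (rule moderate_bound[OF gauge u x]) (auto simp: abs_mult)
    show ?thesis
      using hom_mult[of u x] hom_one net_class_eq_iff[OF gauge ux moderate_const[OF gauge, of 1]] u x
      by (simp add: moderate_ring_def)
  qed
  show ?thesis
  proof
    assume "net_class \<rho> x \<in> Units (gen_ring \<rho>)"
    then obtain U where U: "U \<in> carrier (gen_ring \<rho>)"
      "U \<otimes>\<^bsub>gen_ring \<rho>\<^esub> net_class \<rho> x = \<one>\<^bsub>gen_ring \<rho>\<^esub>"
      by (auto simp: Units_def)
    then obtain u where u: "u \<in> moderate_nets \<rho>" "U = net_class \<rho> u"
      using carrier_gen_ring[OF gauge] by auto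
    obtain N :: nat where N: "\<forall>\<^sup>0\<epsilon>. \<bar>u \<epsilon>\<bar> \<le> inverse (\<rho> \<epsilon> ^ N)" using u(1) by (rule moderateE[OF gauge])
    \<comment> \<open>The first power is enough: with \<rho> \<le> 1/2 it yields |u x| \<ge> 1 -
      \<rho> \<ge> \<rho>, and dividing by the bound on u costs N further powers.\<close>
    have "\<forall>\<^sup>0\<epsilon>. \<bar>(\<lambda>\<epsilon>\<in>{0<..1}. u \<epsilon> * x \<epsilon>) \<epsilon> - ?one \<epsilon>\<bar> \<le> \<rho> \<epsilon> ^ 1"
      using U(2) prod[OF u(1)] u(2) unfolding net_equiv_def by blast
    from for_small_conj[OF this N]
    have "\<forall>\<^sup>0\<epsilon>. \<rho> \<epsilon> ^ Suc N \<le> \<bar>x \<epsilon>\<bar>"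
    proof (rule for_small_elim2[OF _ gauge_less_half[OF gauge]])
      fix \<epsilon> :: real assume e: "0 < \<epsilon>" "\<epsilon> \<le> 1" and half: "\<rho> \<epsilon> \<le> 1 / 2"
        and h: "\<bar>(\<lambda>\<epsilon>\<in>{0<..1}. u \<epsilon> * x \<epsilon>) \<epsilon> - ?one \<epsilon>\<bar> \<le> \<rho> \<epsilon> ^ 1 \<and> \<bar>u \<epsilon>\<bar> \<le> inverse (\<rho> \<epsilon> ^ N)"
      note pos = gauge_pos[OF gauge e]
      have "\<rho> \<epsilon> \<le> \<bar>u \<epsilon> * x \<epsilon>\<bar>" using h half e by auto
      also have "\<dots> \<le> inverse (\<rho> \<epsilon> ^ N) * \<bar>x \<epsilon>\<bar>"
        using h by (simp add: abs_mult mult_right_mono)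
      finally show "\<rho> \<epsilon> ^ Suc N \<le> \<bar>x \<epsilon>\<bar>" using pos by (simp add: field_simps)
    qed
    then show "\<exists>m. \<forall>\<^sup>0\<epsilon>. \<rho> \<epsilon> ^ m \<le> \<bar>x \<epsilon>\<bar>" ..
  next
    assume "\<exists>m. \<forall>\<^sup>0\<epsilon>. \<rho> \<epsilon> ^ m \<le> \<bar>x \<epsilon>\<bar>"
    then obtain m where m: "\<forall>\<^sup>0\<epsilon>. \<rho> \<epsilon> ^ m \<le> \<bar>x \<epsilon>\<bar>" ..
    \<comment> \<open>Where x vanishes, this takes the default value 0. The lower bound excludes
      that for small \<epsilon>, and other \<epsilon> do not affect the class.\<close>
    let ?u = "\<lambda>\<epsilon>\<in>{0<..1}. inverse (x \<epsilon>)"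
    have "\<forall>\<^sup>0\<epsilon>. \<bar>?u \<epsilon>\<bar> \<le> inverse (\<rho> \<epsilon> ^ m)"
      using m by (rule for_small_mono) (use gauge_pos(1)[OF gauge] in \<open>auto intro!: le_imp_inverse_le\<close>)
    then have u: "?u \<in> moderate_nets \<rho>" unfolding moderate_nets_def by (auto simp del: restrict_apply)
    have "\<forall>\<^sup>0\<epsilon>. (\<lambda>\<epsilon>\<in>{0<..1}. ?u \<epsilon> * x \<epsilon>) \<epsilon> = ?one \<epsilon>"
    proof (rule for_small_mono[OF m])
      fix \<epsilon> :: real assume e: "0 < \<epsilon>" "\<epsilon> \<le> 1" and "\<rho> \<epsilon> ^ m \<le> \<bar>x \<epsilon>\<bar>"
      then have "x \<epsilon> \<noteq> 0" using zero_less_power[OF gauge_pos(1)[OF gauge e], of m] by auto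
      then show "(\<lambda>\<epsilon>\<in>{0<..1}. ?u \<epsilon> * x \<epsilon>) \<epsilon> = ?one \<epsilon>" using e by simp
    qed
    then have inv: "net_class \<rho> ?u \<otimes>\<^bsub>gen_ring \<rho>\<^esub> net_class \<rho> x = \<one>\<^bsub>gen_ring \<rho>\<^esub>"
      using prod[OF u] eventually_equiv_imp_net_equiv by blast
    have "net_class \<rho> ?u \<in> carrier (gen_ring \<rho>)" "net_class \<rho> x \<in> carrier (gen_ring \<rho>)"
      using u x carrier_gen_ring[OF gauge] by auto
    with inv show "net_class \<rho> x \<in> Units (gen_ring \<rho>)"
      using S.m_comm[of "net_class \<rho> x" "net_class \<rho> ?u"] unfolding Units_def by auto
  qed
qed

section \<open>The order on representatives\<close>

text \<open>The negligible error is below every power of \<rho>, so the exponent is at the caller's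
  choice and can be fitted to the other error terms.\<close>

lemma gen_le_net_classD:
  assumes "x \<in> moderate_nets \<rho>" "y \<in> moderate_nets \<rho>" "gen_le \<rho> (net_class \<rho> x) (net_class \<rho> y)"
  shows "\<forall>\<^sup>0\<epsilon>. x \<epsilon> \<le> y \<epsilon> + \<rho> \<epsilon> ^ n"
proof -
  obtain z where z: "z \<in> negligible_nets \<rho>" and le: "\<forall>\<^sup>0\<epsilon>. x \<epsilon> \<le> y \<epsilon> + z \<epsilon>"
    using assms gen_le_net_class[OF gauge] by blast
  have "\<forall>\<^sup>0\<epsilon>. \<bar>z \<epsilon> - (\<lambda>\<epsilon>\<in>{0<..1}. 0) \<epsilon>\<bar> \<le> \<rho> \<epsilon> ^ n"
    using z unfolding negligible_nets_def net_equiv_def by blast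
  then show ?thesis by (rule for_small_elim2[OF le]) auto
qed

lemma gen_le_net_classI:
  assumes "x \<in> moderate_nets \<rho>" "y \<in> moderate_nets \<rho>" "\<forall>\<^sup>0\<epsilon>. x \<epsilon> \<le> y \<epsilon>"
  shows "gen_le \<rho> (net_class \<rho> x) (net_class \<rho> y)"
proof -
  have "(\<lambda>\<epsilon>\<in>{0<..1}. 0) \<in> negligible_nets \<rho>"
    using net_equiv_refl[OF gauge] by (simp add: negligible_nets_def)
  moreover have "\<forall>\<^sup>0\<epsilon>. x \<epsilon> \<le> y \<epsilon> + (\<lambda>\<epsilon>\<in>{0<..1}. 0) \<epsilon>"
    using assms(3) by (rule for_small_mono) simp
  ultimately show ?thesis using gen_le_net_class[OF gauge assms(1,2)] by blast
qed

text \<open>Invertibility keeps y - x away from 0 by some \<rho>^m, and the weak inequality decides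
  its sign. Conversely, a positive gap gives both the weak inequality and the lower bound that makes
  y - x a unit.\<close>

lemma gen_less_net_class:
  assumes x: "x \<in> moderate_nets \<rho>" and y: "y \<in> moderate_nets \<rho>"
  shows "gen_less \<rho> (net_class \<rho> x) (net_class \<rho> y) \<longleftrightarrow> (\<exists>m. \<forall>\<^sup>0\<epsilon>. x \<epsilon> + \<rho> \<epsilon> ^ m \<le> y \<epsilon>)"
proof -
  let ?d = "\<lambda>\<epsilon>\<in>{0<..1}. y \<epsilon> - x \<epsilon>"
  have unit: "net_class \<rho> y \<ominus>\<^bsub>gen_ring \<rho>\<^esub> net_class \<rho> x \<in> Units (gen_ring \<rho>)
      \<longleftrightarrow> (\<exists>m. \<forall>\<^sup>0\<epsilon>. \<rho> \<epsilon> ^ m \<le> \<bar>?d \<epsilon>\<bar>)"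
    by (simp only: net_class_diff[OF y x] net_class_Units_iff[OF moderate_diff[OF y x]])
  show ?thesis
  proof
    assume less: "gen_less \<rho> (net_class \<rho> x) (net_class \<rho> y)"
    then obtain m where m: "\<forall>\<^sup>0\<epsilon>. \<rho> \<epsilon> ^ m \<le> \<bar>?d \<epsilon>\<bar>" unfolding gen_less_def unit by blast
    \<comment> \<open>One power more than m: since 0 < \<rho>^(m+1) < \<rho>^m for small \<epsilon>,
      the bound y - x \<ge> -\<rho>^(m+1) rules out y - x \<le> -\<rho>^m.\<close>
    have "\<forall>\<^sup>0\<epsilon>. x \<epsilon> \<le> y \<epsilon> + \<rho> \<epsilon> ^ Suc m"
      using less gen_le_net_classD[OF x y] by (simp only: gen_less_def)
    note * = for_small_conj[OF m this]
    have "\<forall>\<^sup>0\<epsilon>. x \<epsilon> + \<rho> \<epsilon> ^ m \<le> y \<epsilon>"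
    proof (rule for_small_elim2[OF * gauge_half_power])
      fix \<epsilon> :: real assume e: "0 < \<epsilon>" "\<epsilon> \<le> 1" and half: "\<forall>n. 2 * \<rho> \<epsilon> ^ Suc n \<le> \<rho> \<epsilon> ^ n"
        and h: "\<rho> \<epsilon> ^ m \<le> \<bar>?d \<epsilon>\<bar> \<and> x \<epsilon> \<le> y \<epsilon> + \<rho> \<epsilon> ^ Suc m"
      have "0 < \<rho> \<epsilon> ^ Suc m" "2 * \<rho> \<epsilon> ^ Suc m \<le> \<rho> \<epsilon> ^ m"
        using gauge_pos[OF gauge e] half by (auto simp del: power_Suc)
      then show "x \<epsilon> + \<rho> \<epsilon> ^ m \<le> y \<epsilon>" using h e by (auto simp del: power_Suc)
    qed
    then show "\<exists>m. \<forall>\<^sup>0\<epsilon>. x \<epsilon> + \<rho> \<epsilon> ^ m \<le> y \<epsilon>" ..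
  next
    assume "\<exists>m. \<forall>\<^sup>0\<epsilon>. x \<epsilon> + \<rho> \<epsilon> ^ m \<le> y \<epsilon>"
    then obtain m where m: "\<forall>\<^sup>0\<epsilon>. x \<epsilon> + \<rho> \<epsilon> ^ m \<le> y \<epsilon>" ..
    have "\<forall>\<^sup>0\<epsilon>. \<rho> \<epsilon> ^ m \<le> \<bar>?d \<epsilon>\<bar>" using m by (rule for_small_mono) auto
    moreover have "\<forall>\<^sup>0\<epsilon>. x \<epsilon> \<le> y \<epsilon>"
    proof (rule for_small_mono[OF m])
      fix \<epsilon> :: real assume e: "0 < \<epsilon>" "\<epsilon> \<le> 1" and "x \<epsilon> + \<rho> \<epsilon> ^ m \<le> y \<epsilon>"
      then show "x \<epsilon> \<le> y \<epsilon>" using zero_less_power[OF gauge_pos(1)[OF gauge e], of m] by linarith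
    qed
    ultimately show "gen_less \<rho> (net_class \<rho> x) (net_class \<rho> y)"
      unfolding gen_less_def unit using gen_le_net_classI[OF x y] by blast
  qed
qed

section \<open>Distance to a limit on representatives\<close>

lemma gen_less_abs_diff_gauge_power:
  assumes x: "x \<in> moderate_nets \<rho>" and l: "l \<in> moderate_nets \<rho>"
  shows "gen_less \<rho> (gen_abs \<rho> (net_class \<rho> x \<ominus>\<^bsub>gen_ring \<rho>\<^esub> net_class \<rho> l)) (net_class \<rho> \<rho> [^]\<^bsub>gen_ring \<rho>\<^esub> q)
    \<longleftrightarrow> (\<exists>m. \<forall>\<^sup>0\<epsilon>. \<bar>x \<epsilon> - l \<epsilon>\<bar> + \<rho> \<epsilon> ^ m \<le> \<rho> \<epsilon> ^ q)"
proof -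
  let ?d = "\<lambda>\<epsilon>\<in>{0<..1}. x \<epsilon> - l \<epsilon>"
  note d = moderate_diff[OF x l]
  have "(\<forall>\<^sup>0\<epsilon>. (\<lambda>\<epsilon>\<in>{0<..1}. \<bar>?d \<epsilon>\<bar>) \<epsilon> + \<rho> \<epsilon> ^ m \<le> (\<lambda>\<epsilon>\<in>{0<..1}. \<rho> \<epsilon> ^ q) \<epsilon>)
      \<longleftrightarrow> (\<forall>\<^sup>0\<epsilon>. \<bar>x \<epsilon> - l \<epsilon>\<bar> + \<rho> \<epsilon> ^ m \<le> \<rho> \<epsilon> ^ q)" for m
    by (rule iffI; erule for_small_mono; simp)
  then show ?thesis
    by (simp only: net_class_diff[OF x l] gen_abs_net_class[OF gauge d] net_class_gauge_power
        gen_less_net_class[OF moderate_abs[OF d] moderate_gauge_power])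
qed

lemma gen_less_abs_diff_gauge_powerD:
  assumes "x \<in> moderate_nets \<rho>" "l \<in> moderate_nets \<rho>"
    and "gen_less \<rho> (gen_abs \<rho> (net_class \<rho> x \<ominus>\<^bsub>gen_ring \<rho>\<^esub> net_class \<rho> l)) (net_class \<rho> \<rho> [^]\<^bsub>gen_ring \<rho>\<^esub> q)"
  shows "\<forall>\<^sup>0\<epsilon>. \<bar>x \<epsilon> - l \<epsilon>\<bar> \<le> \<rho> \<epsilon> ^ q"
proof -
  obtain m where "\<forall>\<^sup>0\<epsilon>. \<bar>x \<epsilon> - l \<epsilon>\<bar> + \<rho> \<epsilon> ^ m \<le> \<rho> \<epsilon> ^ q"
    using assms gen_less_abs_diff_gauge_power by blast
  then show ?thesis
  proof (rule for_small_mono)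
    fix \<epsilon> :: real assume e: "0 < \<epsilon>" "\<epsilon> \<le> 1" and "\<bar>x \<epsilon> - l \<epsilon>\<bar> + \<rho> \<epsilon> ^ m \<le> \<rho> \<epsilon> ^ q"
    then show "\<bar>x \<epsilon> - l \<epsilon>\<bar> \<le> \<rho> \<epsilon> ^ q"
      using zero_less_power[OF gauge_pos(1)[OF gauge e], of m] by linarith
  qed
qed

text \<open>Strictness demands a gap that is itself a power of \<rho>. Spending one exponent
  supplies it, since \<rho>^(q+1) + \<rho>^(q+1) \<le> \<rho>^q for small \<epsilon>.\<close>

lemma gen_less_abs_diff_gauge_powerI:
  assumes x: "x \<in> moderate_nets \<rho>" and l: "l \<in> moderate_nets \<rho>"
    and "\<forall>\<^sup>0\<epsilon>. \<bar>x \<epsilon> - l \<epsilon>\<bar> \<le> \<rho> \<epsilon> ^ Suc q"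
  shows "gen_less \<rho> (gen_abs \<rho> (net_class \<rho> x \<ominus>\<^bsub>gen_ring \<rho>\<^esub> net_class \<rho> l)) (net_class \<rho> \<rho> [^]\<^bsub>gen_ring \<rho>\<^esub> q)"
proof -
  have "\<forall>\<^sup>0\<epsilon>. \<bar>x \<epsilon> - l \<epsilon>\<bar> + \<rho> \<epsilon> ^ Suc q \<le> \<rho> \<epsilon> ^ q"
  proof (rule for_small_elim2[OF assms(3) gauge_half_power])
    fix \<epsilon> :: real
    assume "\<bar>x \<epsilon> - l \<epsilon>\<bar> \<le> \<rho> \<epsilon> ^ Suc q" "\<forall>n. 2 * \<rho> \<epsilon> ^ Suc n \<le> \<rho> \<epsilon> ^ n"
    then show "\<bar>x \<epsilon> - l \<epsilon>\<bar> + \<rho> \<epsilon> ^ Suc q \<le> \<rho> \<epsilon> ^ q" by (smt (verit))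
  qed
  then show ?thesis using gen_less_abs_diff_gauge_power[OF x l] by blast
qed

end

section \<open>Common thresholds for hypersequences\<close>

text \<open>The order on \<open>hypernat\<close> is not total, so neither threshold need dominate
  the other. The pointwise maximum of representatives does: it is again a net of naturals, and
  moderate because its modulus is at most |a| + |b|.\<close>

lemma hypernat_upper_bound:
  assumes gauge: "gauge_net \<sigma>" and "M \<in> hypernat \<sigma>" "M' \<in> hypernat \<sigma>"
  obtains K where "K \<in> hypernat \<sigma>"
    and "\<And>n. n \<in> hypernat \<sigma> \<Longrightarrow> gen_le \<sigma> K n \<Longrightarrow> gen_le \<sigma> M n \<and> gen_le \<sigma> M' n"
proof -
  obtain a b where a: "a \<in> moderate_nets \<sigma>" "\<forall>\<epsilon>\<in>{0<..1}. a \<epsilon> \<in> \<nat>" "M = net_class \<sigma> a"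
    and b: "b \<in> moderate_nets \<sigma>" "\<forall>\<epsilon>\<in>{0<..1}. b \<epsilon> \<in> \<nat>" "M' = net_class \<sigma> b"
    using assms(2,3) by (auto simp: hypernat_def)
  let ?k = "\<lambda>\<epsilon>\<in>{0<..1}. max (a \<epsilon>) (b \<epsilon>)"
  have k: "?k \<in> moderate_nets \<sigma>"
    by (rule moderate_bound[OF gauge a(1) b(1)]) (auto simp: max_def)
  show thesis
  proof
    show "net_class \<sigma> ?k \<in> hypernat \<sigma>"
      using k a(2) b(2) by (auto simp: hypernat_def max_def intro!: exI[of _ ?k])
  next
    fix n assume n: "n \<in> hypernat \<sigma>" and le: "gen_le \<sigma> (net_class \<sigma> ?k) n"
    obtain c where c: "c \<in> moderate_nets \<sigma>" "n = net_class \<sigma> c"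
      using n by (auto simp: hypernat_def)
    obtain z where z: "z \<in> negligible_nets \<sigma>" "\<forall>\<^sup>0\<epsilon>. ?k \<epsilon> \<le> c \<epsilon> + z \<epsilon>"
      using le gen_le_net_class[OF gauge k c(1)] c(2) by blast
    \<comment> \<open>The negligible net that witnesses the inequality for the maximum serves both
      of its arguments.\<close>
    have "\<forall>\<^sup>0\<epsilon>. a \<epsilon> \<le> c \<epsilon> + z \<epsilon>" "\<forall>\<^sup>0\<epsilon>. b \<epsilon> \<le> c \<epsilon> + z \<epsilon>"
      by (rule for_small_mono[OF z(2)]; simp)+
    then show "gen_le \<sigma> M n \<and> gen_le \<sigma> M' n"
      using z(1) a b c gen_le_net_class[OF gauge] by blast
  qed
qed

lemma has_hyperlimit_common_threshold:
  fixes q :: nat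
  assumes "gauge_net \<sigma>" "has_hyperlimit \<sigma> \<rho> x l" "has_hyperlimit \<sigma> \<rho> y m"
  obtains M where "M \<in> hypernat \<sigma>"
    and "\<And>n. n \<in> hypernat \<sigma> \<Longrightarrow> gen_le \<sigma> M n \<Longrightarrow>
      gen_less \<rho> (gen_abs \<rho> (x n \<ominus>\<^bsub>gen_ring \<rho>\<^esub> l)) (net_class \<rho> \<rho> [^]\<^bsub>gen_ring \<rho>\<^esub> q) \<and>
      gen_less \<rho> (gen_abs \<rho> (y n \<ominus>\<^bsub>gen_ring \<rho>\<^esub> m)) (net_class \<rho> \<rho> [^]\<^bsub>gen_ring \<rho>\<^esub> q)"
proof -
  obtain A where A: "A \<in> hypernat \<sigma>" "\<And>n. n \<in> hypernat \<sigma> \<Longrightarrow> gen_le \<sigma> A n \<Longrightarrow>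
      gen_less \<rho> (gen_abs \<rho> (x n \<ominus>\<^bsub>gen_ring \<rho>\<^esub> l)) (net_class \<rho> \<rho> [^]\<^bsub>gen_ring \<rho>\<^esub> q)"
    using assms(2)[unfolded has_hyperlimit_def, THEN conjunct2, THEN spec, of q] by blast
  obtain B where B: "B \<in> hypernat \<sigma>" "\<And>n. n \<in> hypernat \<sigma> \<Longrightarrow> gen_le \<sigma> B n \<Longrightarrow>
      gen_less \<rho> (gen_abs \<rho> (y n \<ominus>\<^bsub>gen_ring \<rho>\<^esub> m)) (net_class \<rho> \<rho> [^]\<^bsub>gen_ring \<rho>\<^esub> q)"
    using assms(3)[unfolded has_hyperlimit_def, THEN conjunct2, THEN spec, of q] by blast
  obtain K where K: "K \<in> hypernat \<sigma>"
    "\<And>n. n \<in> hypernat \<sigma> \<Longrightarrow> gen_le \<sigma> K n \<Longrightarrow> gen_le \<sigma> A n \<and> gen_le \<sigma> B n"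
    by (rule hypernat_upper_bound[OF assms(1) A(1) B(1)]) blast
  show thesis
    by (rule that[OF K(1)]) (use K(2) A(2) B(2) in blast)
qed

section \<open>The comparison and sandwich statements\<close>

text \<open>The limits are separated by some \<rho>^p. Both sequences are brought within
  \<rho>^(p+2) of their limits, which leaves a gap of at least \<rho>^(p+1) between them.\<close>

lemma hyperlimit_less_imp_eventually_less:
  assumes \<rho>: "gauge_net \<rho>" and \<sigma>: "gauge_net \<sigma>"
    and x: "x \<in> hypernat \<sigma> \<rightarrow> carrier (gen_ring \<rho>)" and y: "y \<in> hypernat \<sigma> \<rightarrow> carrier (gen_ring \<rho>)"
    and limx: "has_hyperlimit \<sigma> \<rho> x l" and limy: "has_hyperlimit \<sigma> \<rho> y m" and less: "gen_less \<rho> l m"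
  shows "\<exists>M\<in>hypernat \<sigma>. \<forall>n\<in>hypernat \<sigma>. gen_le \<sigma> M n \<longrightarrow> gen_less \<rho> (x n) (y n)"
proof -
  have "l \<in> carrier (gen_ring \<rho>)" "m \<in> carrier (gen_ring \<rho>)"
    using limx limy by (auto simp: has_hyperlimit_def)
  then obtain l' m' where l': "l' \<in> moderate_nets \<rho>" "l = net_class \<rho> l'"
    and m': "m' \<in> moderate_nets \<rho>" "m = net_class \<rho> m'"
    unfolding carrier_gen_ring[OF \<rho>] by auto
  obtain p where p: "\<forall>\<^sup>0\<epsilon>. l' \<epsilon> + \<rho> \<epsilon> ^ p \<le> m' \<epsilon>"
    using less gen_less_net_class[OF \<rho> l'(1) m'(1)] l'(2) m'(2) by blast
  obtain M where M: "M \<in> hypernat \<sigma>" "\<And>n. n \<in> hypernat \<sigma> \<Longrightarrow> gen_le \<sigma> M n \<Longrightarrow>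
      gen_less \<rho> (gen_abs \<rho> (x n \<ominus>\<^bsub>gen_ring \<rho>\<^esub> l)) (net_class \<rho> \<rho> [^]\<^bsub>gen_ring \<rho>\<^esub> Suc (Suc p)) \<and>
      gen_less \<rho> (gen_abs \<rho> (y n \<ominus>\<^bsub>gen_ring \<rho>\<^esub> m)) (net_class \<rho> \<rho> [^]\<^bsub>gen_ring \<rho>\<^esub> Suc (Suc p))"
    using has_hyperlimit_common_threshold[OF \<sigma> limx limy, of "Suc (Suc p)"] by blast
  have "gen_less \<rho> (x n) (y n)" if n: "n \<in> hypernat \<sigma>" "gen_le \<sigma> M n" for n
  proof -
    obtain x' y' where x': "x' \<in> moderate_nets \<rho>" "x n = net_class \<rho> x'"
      and y': "y' \<in> moderate_nets \<rho>" "y n = net_class \<rho> y'"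
      using x y n(1) unfolding carrier_gen_ring[OF \<rho>] by blast
    have "\<forall>\<^sup>0\<epsilon>. \<bar>x' \<epsilon> - l' \<epsilon>\<bar> \<le> \<rho> \<epsilon> ^ Suc (Suc p)" "\<forall>\<^sup>0\<epsilon>. \<bar>y' \<epsilon> - m' \<epsilon>\<bar> \<le> \<rho> \<epsilon> ^ Suc (Suc p)"
      using M(2)[OF n] gen_less_abs_diff_gauge_powerD[OF \<rho> x'(1) l'(1)]
        gen_less_abs_diff_gauge_powerD[OF \<rho> y'(1) m'(1)]
      unfolding x'(2) y'(2) l'(2) m'(2) by blast+
    note est = for_small_conj[OF this]
    have "\<forall>\<^sup>0\<epsilon>. x' \<epsilon> + \<rho> \<epsilon> ^ Suc p \<le> y' \<epsilon>"
    proof (rule for_small_elim2[OF for_small_conj[OF est p] gauge_half_power[OF \<rho>]])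
      fix \<epsilon> :: real
      assume h: "(\<bar>x' \<epsilon> - l' \<epsilon>\<bar> \<le> \<rho> \<epsilon> ^ Suc (Suc p) \<and> \<bar>y' \<epsilon> - m' \<epsilon>\<bar> \<le> \<rho> \<epsilon> ^ Suc (Suc p)) \<and>
          l' \<epsilon> + \<rho> \<epsilon> ^ p \<le> m' \<epsilon>" and half: "\<forall>n. 2 * \<rho> \<epsilon> ^ Suc n \<le> \<rho> \<epsilon> ^ n"
      \<comment> \<open>The two errors add up to 2 \<rho>^(p+2) \<le> \<rho>^(p+1); together with
        the remaining gap \<rho>^(p+1) they fit into 2 \<rho>^(p+1) \<le> \<rho>^p.\<close>
      show "x' \<epsilon> + \<rho> \<epsilon> ^ Suc p \<le> y' \<epsilon>"
        using h half[rule_format, of p] half[rule_format, of "Suc p"] by linarith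
    qed
    then show ?thesis using gen_less_net_class[OF \<rho> x'(1) y'(1)] unfolding x'(2) y'(2) by blast
  qed
  with M(1) show ?thesis by blast
qed

lemma hyperlimit_sandwich:
  assumes \<rho>: "gauge_net \<rho>" and \<sigma>: "gauge_net \<sigma>"
    and x: "x \<in> hypernat \<sigma> \<rightarrow> carrier (gen_ring \<rho>)" and y: "y \<in> hypernat \<sigma> \<rightarrow> carrier (gen_ring \<rho>)"
    and z: "z \<in> hypernat \<sigma> \<rightarrow> carrier (gen_ring \<rho>)"
    and le: "\<And>n. n \<in> hypernat \<sigma> \<Longrightarrow> gen_le \<rho> (x n) (y n) \<and> gen_le \<rho> (y n) (z n)"
    and limx: "has_hyperlimit \<sigma> \<rho> x l" and limz: "has_hyperlimit \<sigma> \<rho> z l"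
  shows "has_hyperlimit \<sigma> \<rho> y l"
  unfolding has_hyperlimit_def
proof (intro conjI allI)
  show l: "l \<in> carrier (gen_ring \<rho>)" using limx by (simp add: has_hyperlimit_def)
  fix q :: nat
  \<comment> \<open>Two extra exponents: one absorbs the sum of the limit error and the negligible
    error of the order, the other provides the gap for strictness.\<close>
  let ?s = "Suc (Suc q)"
  obtain l' where l': "l' \<in> moderate_nets \<rho>" "l = net_class \<rho> l'"
    using l unfolding carrier_gen_ring[OF \<rho>] by auto
  obtain M where M: "M \<in> hypernat \<sigma>" "\<And>n. n \<in> hypernat \<sigma> \<Longrightarrow> gen_le \<sigma> M n \<Longrightarrow>
      gen_less \<rho> (gen_abs \<rho> (x n \<ominus>\<^bsub>gen_ring \<rho>\<^esub> l)) (net_class \<rho> \<rho> [^]\<^bsub>gen_ring \<rho>\<^esub> ?s) \<and>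
      gen_less \<rho> (gen_abs \<rho> (z n \<ominus>\<^bsub>gen_ring \<rho>\<^esub> l)) (net_class \<rho> \<rho> [^]\<^bsub>gen_ring \<rho>\<^esub> ?s)"
    using has_hyperlimit_common_threshold[OF \<sigma> limx limz, of ?s] by blast
  have "gen_less \<rho> (gen_abs \<rho> (y n \<ominus>\<^bsub>gen_ring \<rho>\<^esub> l)) (net_class \<rho> \<rho> [^]\<^bsub>gen_ring \<rho>\<^esub> q)"
    if n: "n \<in> hypernat \<sigma>" "gen_le \<sigma> M n" for n
  proof -
    obtain x' y' z' where x': "x' \<in> moderate_nets \<rho>" "x n = net_class \<rho> x'"
      and y': "y' \<in> moderate_nets \<rho>" "y n = net_class \<rho> y'"
      and z': "z' \<in> moderate_nets \<rho>" "z n = net_class \<rho> z'"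
      using x y z n(1) unfolding carrier_gen_ring[OF \<rho>] by blast
    have xz: "\<forall>\<^sup>0\<epsilon>. \<bar>x' \<epsilon> - l' \<epsilon>\<bar> \<le> \<rho> \<epsilon> ^ ?s" "\<forall>\<^sup>0\<epsilon>. \<bar>z' \<epsilon> - l' \<epsilon>\<bar> \<le> \<rho> \<epsilon> ^ ?s"
      using M(2)[OF n] gen_less_abs_diff_gauge_powerD[OF \<rho> x'(1) l'(1)]
        gen_less_abs_diff_gauge_powerD[OF \<rho> z'(1) l'(1)]
      unfolding x'(2) z'(2) l'(2) by blast+
    \<comment> \<open>The order errors get the same exponent as the limit errors, so that on either
      side y deviates from l by at most 2 \<rho>^(q+2) \<le> \<rho>^(q+1).\<close>
    have xyz: "\<forall>\<^sup>0\<epsilon>. x' \<epsilon> \<le> y' \<epsilon> + \<rho> \<epsilon> ^ ?s" "\<forall>\<^sup>0\<epsilon>. y' \<epsilon> \<le> z' \<epsilon> + \<rho> \<epsilon> ^ ?s"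
      using le[OF n(1)] gen_le_net_classD[OF \<rho> x'(1) y'(1)] gen_le_net_classD[OF \<rho> y'(1) z'(1)]
      unfolding x'(2) y'(2) z'(2) by blast+
    have "\<forall>\<^sup>0\<epsilon>. \<bar>y' \<epsilon> - l' \<epsilon>\<bar> \<le> \<rho> \<epsilon> ^ Suc q"
    proof (rule for_small_elim2[OF for_small_conj[OF for_small_conj[OF xz] for_small_conj[OF xyz]]
          gauge_half_power[OF \<rho>]])
      fix \<epsilon> :: real
      assume h: "(\<bar>x' \<epsilon> - l' \<epsilon>\<bar> \<le> \<rho> \<epsilon> ^ ?s \<and> \<bar>z' \<epsilon> - l' \<epsilon>\<bar> \<le> \<rho> \<epsilon> ^ ?s) \<and>
          x' \<epsilon> \<le> y' \<epsilon> + \<rho> \<epsilon> ^ ?s \<and> y' \<epsilon> \<le> z' \<epsilon> + \<rho> \<epsilon> ^ ?s"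
        and half: "\<forall>n. 2 * \<rho> \<epsilon> ^ Suc n \<le> \<rho> \<epsilon> ^ n"
      show "\<bar>y' \<epsilon> - l' \<epsilon>\<bar> \<le> \<rho> \<epsilon> ^ Suc q"
        using h half[rule_format, of "Suc q"] by linarith
    qed
    then show ?thesis using gen_less_abs_diff_gauge_powerI[OF \<rho> y'(1) l'(1)] y'(2) l'(2) by simp
  qed
  with M(1) show "\<exists>M\<in>hypernat \<sigma>. \<forall>n\<in>hypernat \<sigma>. gen_le \<sigma> M n \<longrightarrow>
      gen_less \<rho> (gen_abs \<rho> (y n \<ominus>\<^bsub>gen_ring \<rho>\<^esub> l)) (net_class \<rho> \<rho> [^]\<^bsub>gen_ring \<rho>\<^esub> q)" by blast
qed

text \<open>Since \<open>has_hyperlimit\<close> is a relation, existence and value of a hyperlimit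
  are expressed together, by assuming the relation for l and m and quantifying over them.\<close>

theorem theorem38:
  fixes \<rho> \<sigma> :: "real \<Rightarrow> real"
    and x y z :: "(real \<Rightarrow> real) set \<Rightarrow> (real \<Rightarrow> real) set"
  assumes "gauge_net \<rho>" and "gauge_net \<sigma>"
    and "x \<in> hypernat \<sigma> \<rightarrow> carrier (gen_ring \<rho>)"
    and "y \<in> hypernat \<sigma> \<rightarrow> carrier (gen_ring \<rho>)"
    and "z \<in> hypernat \<sigma> \<rightarrow> carrier (gen_ring \<rho>)"
  shows "(\<forall>l m. has_hyperlimit \<sigma> \<rho> x l \<and> has_hyperlimit \<sigma> \<rho> y m \<and> gen_less \<rho> l m \<longrightarrow>
            (\<exists>M\<in>hypernat \<sigma>. \<forall>n\<in>hypernat \<sigma>. gen_le \<sigma> M n \<longrightarrow> gen_less \<rho> (x n) (y n)))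
       \<and> (\<forall>l. (\<forall>n\<in>hypernat \<sigma>. gen_le \<rho> (x n) (y n) \<and> gen_le \<rho> (y n) (z n)) \<and>
              has_hyperlimit \<sigma> \<rho> x l \<and> has_hyperlimit \<sigma> \<rho> z l \<longrightarrow>
            has_hyperlimit \<sigma> \<rho> y l)"
proof (intro conjI allI impI; elim conjE)
  fix l m
  assume "has_hyperlimit \<sigma> \<rho> x l" "has_hyperlimit \<sigma> \<rho> y m" "gen_less \<rho> l m"
  then show "\<exists>M\<in>hypernat \<sigma>. \<forall>n\<in>hypernat \<sigma>. gen_le \<sigma> M n \<longrightarrow> gen_less \<rho> (x n) (y n)"
    by (rule hyperlimit_less_imp_eventually_less[OF assms(1-4)])
next
  fix l
  assume "\<forall>n\<in>hypernat \<sigma>. gen_le \<rho> (x n) (y n) \<and> gen_le \<rho> (y n) (z n)"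
    and "has_hyperlimit \<sigma> \<rho> x l" "has_hyperlimit \<sigma> \<rho> z l"
  then show "has_hyperlimit \<sigma> \<rho> y l"
    by (intro hyperlimit_sandwich[OF assms]) auto
qed

end
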